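(* Let $N',M\geq 2$ be integers with $\gcd(M,N')=1$, and set $N=N'M$. Let $a\geq 0$ and $b\neq 0$ be integers with $\gcd(b,N')=1$, and let $s$ be the integer with $0\leq s\leq N'-1$ and $a\equiv bs \bmod N'$. Let $t$ be any integer with $0\leq t\leq M-1$, and let $r$ be the integer with $0\leq r\leq N-1$, $r\equiv s\bmod N'$ and $r\equiv t\bmod M$. Let $\Lambda=\langle (N,0),(r,1)\rangle\subseteq\mathbb{Z}^2$ be the lattice generated over $\mathbb{Z}$ by $(N,0)$ and $(r,1)$. Suppose that $(a^2+b^2)M<N'$. Then, for all nonzero $(x,y)\in\Lambda$ with $x^2+y^2<N$, we have $y\neq 0$ and $\frac{x}{y}=\frac{a}{b}$. Furthermore, if $\gcd(a,b)=1$ and $(x,y)$ is a shortest nonzero vector in $\Lambda$ (with respect to the Euclidean norm), then also $\gcd(x,y)\mid M$. *)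

theory Defs
  imports "HOL-Analysis.Product_Vector" "HOL-Number_Theory.Cong"
begin

definition int_lattice2 :: "int \<times> int \<Rightarrow> int \<times> int \<Rightarrow> (int \<times> int) set" where
  "int_lattice2 v w = {(k * fst v + l * fst w, k * snd v + l * snd w) | k l. True}"

(* The library norm on real \<times> real is the Euclidean (L2) norm, see norm_Pair. *)
definition euclidean_norm :: "int \<times> int \<Rightarrow> real" where
  "euclidean_norm v = norm (real_of_int (fst v), real_of_int (snd v))"

definition shortest_nonzero_vector :: "(int \<times> int) set \<Rightarrow> int \<times> int \<Rightarrow> bool" where
  "shortest_nonzero_vector L v \<longleftrightarrow>
     v \<in> L \<and> v \<noteq> (0, 0) \<and>
     (\<forall>w \<in> L. w \<noteq> (0, 0) \<longrightarrow> euclidean_norm v \<le> euclidean_norm w)"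

end

theory Submission
  imports Defs
begin

text \<open>Any \<open>(x, y) \<in> \<Lambda>\<close> satisfies \<open>b x \<equiv> a y (mod N')\<close>, while by Cauchy--Schwarz
  \<open>(b x - a y)\<^sup>2 \<le> (a\<^sup>2 + b\<^sup>2)(x\<^sup>2 + y\<^sup>2) < N'\<^sup>2\<close> for short vectors, so \<open>b x = a y\<close>. The
  vector \<open>M (a, b)\<close> lies in \<open>\<Lambda>\<close> and is short, so a shortest vector is \<open>k (a, b)\<close> with \<open>k\<close>
  minimal; the multiples of \<open>(a, b)\<close> lying in \<open>\<Lambda>\<close> form a subgroup, hence \<open>k dvd M\<close>.\<close>

text \<open>The second coordinate forces the coefficient of \<open>(r, 1)\<close> to be
  \<open>y\<close>, so only a divisibility condition on the first coordinate remains.\<close>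

lemma mem_int_lattice2_iff:
  "(x, y) \<in> int_lattice2 (N, 0) (r, 1) \<longleftrightarrow> N dvd x - r * y"
proof
  assume "(x, y) \<in> int_lattice2 (N, 0) (r, 1)"
  then show "N dvd x - r * y"
    by (auto simp: int_lattice2_def mult.commute)
next
  assume "N dvd x - r * y"
  then obtain k where "x - r * y = N * k" ..
  then have "x = k * N + y * r"
    by (simp add: algebra_simps)
  then show "(x, y) \<in> int_lattice2 (N, 0) (r, 1)"
    by (auto simp: int_lattice2_def)
qed

text \<open>Moves the minimality of a shortest vector from real norms to integer sums of
  squares.\<close>

lemma euclidean_norm_le_iff:
  "euclidean_norm (x, y) \<le> euclidean_norm (u, v) \<longleftrightarrow> x\<^sup>2 + y\<^sup>2 \<le> u\<^sup>2 + v\<^sup>2"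
proof -
  have "euclidean_norm (x, y) \<le> euclidean_norm (u, v)
      \<longleftrightarrow> real_of_int (x\<^sup>2 + y\<^sup>2) \<le> real_of_int (u\<^sup>2 + v\<^sup>2)"
    by (simp add: euclidean_norm_def norm_Pair)
  then show ?thesis
    by (simp only: of_int_le_iff)
qed

text \<open>Lagrange's identity bounds the square of \<open>b * x - a * y\<close> by the product of
  the two sums of squares, and a multiple of \<open>n\<close> smaller than \<open>n\<close> in
  absolute value is zero.\<close>

lemma dvd_minus_eqI:
  fixes a b x y n :: int
  assumes "n dvd b * x - a * y" and "(a\<^sup>2 + b\<^sup>2) * (x\<^sup>2 + y\<^sup>2) < n\<^sup>2"
  shows "b * x = a * y"
proof -
  have "(b * x - a * y)\<^sup>2 + (a * x + b * y)\<^sup>2 = (a\<^sup>2 + b\<^sup>2) * (x\<^sup>2 + y\<^sup>2)"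
    by algebra
  then have "(b * x - a * y)\<^sup>2 < n\<^sup>2"
    using assms(2) zero_le_power2[of "a * x + b * y"] by linarith
  then have "\<bar>b * x - a * y\<bar> < \<bar>n\<bar>"
    by (metis abs_le_square_iff not_le)
  then show ?thesis
    using assms(1) dvd_imp_le_int[of "b * x - a * y" n] by auto
qed

lemma proportional_to_coprimeE:
  fixes a b x y :: int
  assumes "b * x = a * y" and "coprime a b" and "b \<noteq> 0"
  obtains k where "x = k * a" and "y = k * b"
proof -
  have "b dvd a * y"
    using assms(1) by (metis dvd_triv_left)
  then have "b dvd y"
    using assms(2) by (simp add: coprime_dvd_mult_right_iff coprime_commute)
  then obtain k where k: "y = k * b"
    by (metis dvdE mult.commute)
  then have "b * x = b * (k * a)"
    using assms(1) by (simp add: algebra_simps)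
  then have "x = k * a"
    using assms(3) by simp
  with k show thesis
    using that by blast
qed

theorem lemma4p3:
  fixes N' M N a b s t r :: int and \<Lambda> :: "(int \<times> int) set"
  assumes "N' \<ge> 2" and "M \<ge> 2" and "gcd M N' = 1" and "N = N' * M"
    and "a \<ge> 0" and "b \<noteq> 0" and "gcd b N' = 1"
    and "0 \<le> s" and "s \<le> N' - 1" and "[a = b * s] (mod N')"
    and "0 \<le> t" and "t \<le> M - 1"
    and "0 \<le> r" and "r \<le> N - 1" and "[r = s] (mod N')" and "[r = t] (mod M)"
    and "\<Lambda> = int_lattice2 (N, 0) (r, 1)"
    and "(a\<^sup>2 + b\<^sup>2) * M < N'"
  shows "(\<forall>x y. (x, y) \<in> \<Lambda> \<and> (x, y) \<noteq> (0, 0) \<and> x\<^sup>2 + y\<^sup>2 < N \<longrightarrow>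
            y \<noteq> 0 \<and> (of_int x / of_int y :: rat) = of_int a / of_int b)
       \<and> (gcd a b = 1 \<longrightarrow>
            (\<forall>x y. shortest_nonzero_vector \<Lambda> (x, y) \<longrightarrow> gcd x y dvd M))"
proof -
  have mem: "(x, y) \<in> \<Lambda> \<longleftrightarrow> N dvd x - r * y" for x y
    using assms(17) by (simp add: mem_int_lattice2_iff)
  \<comment> \<open>Modulo \<open>N'\<close> the residue \<open>s\<close> can be replaced by
    \<open>r\<close>, so \<open>(a, b)\<close> meets the lattice condition modulo \<open>N'\<close>,
    though perhaps not modulo \<open>N\<close>.\<close>
  have "[a = b * r] (mod N')"
    using assms(10,15) by (metis cong_scalar_left cong_sym cong_trans)
  then have N': "N' dvd a - r * b"
    by (simp add: cong_iff_dvd_diff mult.commute)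
  have ab_pos: "a\<^sup>2 + b\<^sup>2 > 0"
    using assms(6) by (simp add: sum_power2_gt_zero_iff)
  have short: "b * x = a * y" if "(x, y) \<in> \<Lambda>" and "x\<^sup>2 + y\<^sup>2 < N" for x y
  proof (rule dvd_minus_eqI)
    have "N' dvd x - r * y"
      using that(1) assms(4) unfolding mem by (metis dvd_mult_left)
    \<comment> \<open>This combination cancels the terms in \<open>r\<close>, leaving
      \<open>b * x - a * y\<close>.\<close>
    then have "N' dvd b * (x - r * y) - y * (a - r * b)"
      using N' by simp
    then show "N' dvd b * x - a * y"
      by (simp add: algebra_simps)
    have "(a\<^sup>2 + b\<^sup>2) * (x\<^sup>2 + y\<^sup>2) < (a\<^sup>2 + b\<^sup>2) * N"
      using ab_pos that(2) by simp
    also have "\<dots> = ((a\<^sup>2 + b\<^sup>2) * M) * N'"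
      using assms(4) by simp
    also have "\<dots> < N' * N'"
      using assms(1,18) by (intro mult_strict_right_mono) auto
    finally show "(a\<^sup>2 + b\<^sup>2) * (x\<^sup>2 + y\<^sup>2) < N'\<^sup>2"
      by (simp add: power2_eq_square)
  qed
  have part1: "y \<noteq> 0 \<and> (of_int x / of_int y :: rat) = of_int a / of_int b"
    if "(x, y) \<in> \<Lambda>" and "(x, y) \<noteq> (0, 0)" and "x\<^sup>2 + y\<^sup>2 < N" for x y
  proof -
    have eq: "b * x = a * y"
      using short that by blast
    \<comment> \<open>If \<open>y = 0\<close>, then \<open>b * x = 0\<close> would force
      \<open>x = 0\<close> as well.\<close>
    with that(2) assms(6) have "y \<noteq> 0"
      by auto
    moreover have "(of_int b * of_int x :: rat) = of_int a * of_int y"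
      using eq by (simp flip: of_int_mult)
    ultimately show ?thesis
      using assms(6) by (simp add: field_simps)
  qed
  have part2: "gcd x y dvd M" if gcd: "gcd a b = 1"
    and shortest: "shortest_nonzero_vector \<Lambda> (x, y)" for x y
  proof -
    have xy: "(x, y) \<in> \<Lambda>" "(x, y) \<noteq> (0, 0)"
      using shortest by (auto simp: shortest_nonzero_vector_def)
    have minimal: "x\<^sup>2 + y\<^sup>2 \<le> (m * a)\<^sup>2 + (m * b)\<^sup>2"
      if "(m * a, m * b) \<in> \<Lambda>" and "m \<noteq> 0" for m
      using shortest that assms(6)
      by (auto simp: shortest_nonzero_vector_def simp flip: euclidean_norm_le_iff)
    \<comment> \<open>Scaling by \<open>M\<close> supplies the factor of \<open>N\<close> that
      divisibility by \<open>N'\<close> lacks.\<close>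
    have "N dvd M * (a - r * b)"
      using N' assms(4) by (simp add: mult.commute mult_dvd_mono)
    then have Mab: "(M * a, M * b) \<in> \<Lambda>"
      by (simp add: mem algebra_simps)
    \<comment> \<open>Comparison with \<open>M * (a, b)\<close> puts the shortest vector below the
      threshold \<open>N\<close>, so \<open>short\<close> applies to it.\<close>
    then have "x\<^sup>2 + y\<^sup>2 \<le> ((a\<^sup>2 + b\<^sup>2) * M) * M"
      using minimal[of M] assms(2) by (simp add: power2_eq_square algebra_simps)
    also have "\<dots> < N' * M"
      using assms(2,18) by (intro mult_strict_right_mono) auto
    finally have "b * x = a * y"
      using short xy(1) assms(4) by blast
    then obtain k where k: "x = k * a" "y = k * b"
      using proportional_to_coprimeE gcd assms(6) by (metis coprime_iff_gcd_eq_1)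
    have "k \<noteq> 0"
      using xy(2) k by auto
    \<comment> \<open>Division with remainder: subtracting \<open>M div k\<close> copies of
      \<open>(x, y)\<close> from \<open>M * (a, b)\<close> leaves the lattice vector
      \<open>m * (a, b)\<close>. It is shorter than \<open>k * (a, b)\<close>, so minimality forces
      \<open>m = 0\<close>.\<close>
    define m where "m = M mod k"
    have "N dvd (M * a - r * (M * b)) - (M div k) * (x - r * y)"
      using Mab xy(1) by (simp add: mem)
    moreover have "(M * a - r * (M * b)) - (M div k) * (x - r * y) = m * a - r * (m * b)"
      by (simp add: m_def k algebra_simps flip: minus_div_mult_eq_mod)
    ultimately have "(m * a, m * b) \<in> \<Lambda>"
      by (simp add: mem)
    moreover have "\<not> x\<^sup>2 + y\<^sup>2 \<le> (m * a)\<^sup>2 + (m * b)\<^sup>2"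
    proof -
      \<comment> \<open>Absolute values are needed because \<open>k\<close> may be negative.\<close>
      have "\<bar>m\<bar> < \<bar>k\<bar>"
        unfolding m_def using \<open>k \<noteq> 0\<close> by (rule abs_mod_less)
      then have "m\<^sup>2 < k\<^sup>2"
        by (metis abs_le_square_iff not_le)
      then have "m\<^sup>2 * (a\<^sup>2 + b\<^sup>2) < k\<^sup>2 * (a\<^sup>2 + b\<^sup>2)"
        using ab_pos by simp
      then show ?thesis
        by (simp add: k power_mult_distrib algebra_simps)
    qed
    ultimately have "m = 0"
      using minimal by blast
    then have "k dvd M"
      by (simp add: m_def mod_eq_0_iff_dvd)
    \<comment> \<open>Since \<open>a\<close> and \<open>b\<close> are coprime,
      \<open>gcd x y\<close> is the absolute value of \<open>k\<close>.\<close>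
    then show ?thesis
      using gcd by (simp add: k gcd_mult_left)
  qed
  show ?thesis
  proof (intro conjI allI impI)
    show "gcd x y dvd M" if "gcd a b = 1" "shortest_nonzero_vector \<Lambda> (x, y)" for x y
      using that by (rule part2)
  qed (use part1 in blast)+
qed

end
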